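(* Let $A,B$ be positive semidefinite $n\times n$ complex matrices, $X$ an $n\times n$ complex matrix and $N\in\mathbb{N}$ with $N\geq 2$. If $0\leq\nu\leq\frac{1}{4}$, then \begin{align*} &\|AX+XB\|_2^2+\sum_{j=2}^{N}s_j(4\nu)\left\|A^{\frac{1}{2}+\frac{k_j(4\nu)}{2^{j+1}}}XB^{\frac{1}{2}-\frac{k_j(4\nu)}{2^{j+1}}}-A^{\frac{1}{2}+\frac{k_j(4\nu)+1}{2^{j+1}}}XB^{\frac{1}{2}-\frac{k_j(4\nu)+1}{2^{j+1}}}\right\|_2^2\\ &\quad+\sum_{j=2}^{N}s_j(4\nu)\left\|A^{\frac{1}{2}-\frac{k_j(4\nu)}{2^{j+1}}}XB^{\frac{1}{2}+\frac{k_j(4\nu)}{2^{j+1}}}-A^{\frac{1}{2}-\frac{k_j(4\nu)+1}{2^{j+1}}}XB^{\frac{1}{2}+\frac{k_j(4\nu)+1}{2^{j+1}}}\right\|_2^2\\ &\leq\|A^{\nu}XB^{1-\nu}+A^{1-\nu}XB^{\nu}\|_2^2+2\nu\|AX-XB\|_2^2\\ &\quad+(1-2\nu)\left(\|A^{\frac{1}{2}}XB^{\frac{1}{2}}-AX\|_2^2+\|A^{\frac{1}{2}}XB^{\frac{1}{2}}-XB\|_2^2\right). \end{align*}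
   Context: $\|\cdot\|_2$ is the Hilbert-Schmidt (Frobenius) norm. $[x]$ denotes the greatest integer $\le x$. For $\nu\in[0,1]$ and $j\geq 1$ put $k_j(\nu)=[2^{j-1}\nu]$, $r_j(\nu)=[2^{j}\nu]$ and $s_j(\nu)=(-1)^{r_j(\nu)}2^{j-1}\nu+(-1)^{r_j(\nu)+1}\left[\frac{r_j(\nu)+1}{2}\right]$. Powers of positive semidefinite matrices are taken by functional calculus, with $A^0=I$. *)

theory Defs
  imports "HOL-Analysis.Analysis"
begin

definition cadjoint :: "complex^'n^'m \<Rightarrow> complex^'m^'n" where
  "cadjoint A = (\<chi> i j. cnj (A $ j $ i))"

definition unitary :: "complex^'n^'n \<Rightarrow> bool" where
  "unitary U \<longleftrightarrow> cadjoint U ** U = mat 1 \<and> U ** cadjoint U = mat 1"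

definition rdiag :: "('n \<Rightarrow> real) \<Rightarrow> complex^'n^'n" where
  "rdiag d = (\<chi> i j. if i = j then complex_of_real (d i) else 0)"

definition psd :: "complex^'n^'n \<Rightarrow> bool" where
  "psd A \<longleftrightarrow> cadjoint A = A \<and> (\<forall>x. 0 \<le> Re (\<Sum>i\<in>UNIV. cnj (x $ i) * (A *v x) $ i))"

(* The functional calculus of a Hermitian matrix A: if A = U diag(d) U* with U unitary and d
   real, the value is U diag(f d) U*. It does not depend on the chosen diagonalization
   (see fun_calc_eq below). *)
definition fun_calc :: "(real \<Rightarrow> real) \<Rightarrow> complex^'n^'n \<Rightarrow> complex^'n^'n" where
  "fun_calc f A = (THE M. \<exists>U d. unitary U \<and> A = U ** rdiag d ** cadjoint U \<and>
                               M = U ** rdiag (f \<circ> d) ** cadjoint U)"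

(* 0 powr 0 = 0 in the library, so exponent 0 is treated separately to obtain A^0 = I,
   also for singular A. *)
definition mpow :: "complex^'n^'n \<Rightarrow> real \<Rightarrow> complex^'n^'n" where
  "mpow A t = fun_calc (\<lambda>x. if t = 0 then 1 else x powr t) A"

definition k_idx :: "nat \<Rightarrow> real \<Rightarrow> int" where
  "k_idx j \<nu> = \<lfloor>2 ^ (j - 1) * \<nu>\<rfloor>"

definition r_idx :: "nat \<Rightarrow> real \<Rightarrow> int" where
  "r_idx j \<nu> = \<lfloor>2 ^ j * \<nu>\<rfloor>"

definition s_coef :: "nat \<Rightarrow> real \<Rightarrow> real" where
  "s_coef j \<nu> = (-1) powi (r_idx j \<nu>) * 2 ^ (j - 1) * \<nu>
     + (-1) powi (r_idx j \<nu> + 1) * of_int \<lfloor>(of_int (r_idx j \<nu>) + 1) / 2 :: real\<rfloor>"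

(* The library norm on complex^'n^'m is the Hilbert-Schmidt norm. *)
lemma norm_eq_hilbert_schmidt:
  fixes A :: "complex^'n^'m"
  shows "norm A = sqrt (\<Sum>i\<in>UNIV. \<Sum>j\<in>UNIV. (cmod (A $ i $ j))\<^sup>2)"
  by (simp add: norm_vec_def L2_set_def sum_nonneg)

lemma rdiag_mult_left: "(rdiag d ** W) $ i $ j = complex_of_real (d i) * W $ i $ j"
  by (simp add: matrix_matrix_mult_def rdiag_def if_distrib[where f = "\<lambda>x. x * _"] cong: if_cong)

lemma rdiag_mult_right: "(W ** rdiag d) $ i $ j = W $ i $ j * complex_of_real (d j)"
  by (simp add: matrix_matrix_mult_def rdiag_def if_distrib[where f = "\<lambda>x. _ * x"] cong: if_cong)

lemma diagonalization_unique:
  assumes U: "unitary U" and V: "unitary V"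
    and eq: "U ** rdiag d ** cadjoint U = V ** rdiag e ** cadjoint V"
  shows "U ** rdiag (f \<circ> d) ** cadjoint U = V ** rdiag (f \<circ> e) ** cadjoint V"
proof -
  define W where "W = cadjoint V ** U"
  have U1: "cadjoint U ** U = mat 1" "U ** cadjoint U = mat 1"
    and V1: "cadjoint V ** V = mat 1" "V ** cadjoint V = mat 1"
    using U V by (auto simp: unitary_def)
  have "W ** rdiag d = cadjoint V ** (U ** rdiag d ** cadjoint U) ** U"
    by (simp add: W_def U1 flip: matrix_mul_assoc)
  also have "\<dots> = rdiag e ** W"
    by (simp add: eq W_def V1 matrix_mul_assoc)
  finally have comm: "W ** rdiag d = rdiag e ** W" .
  have "W ** rdiag (f \<circ> d) = rdiag (f \<circ> e) ** W"
  proof -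
    have "W $ i $ j * complex_of_real (f (d j)) = complex_of_real (f (e i)) * W $ i $ j" for i j
    proof -
      have "W $ i $ j * complex_of_real (d j) = complex_of_real (e i) * W $ i $ j"
        using arg_cong[OF comm, of "\<lambda>M. M $ i $ j"] by (simp only: rdiag_mult_left rdiag_mult_right)
      then have "W $ i $ j = 0 \<or> d j = e i" by auto
      then show ?thesis by auto
    qed
    then show ?thesis by (simp add: vec_eq_iff rdiag_mult_left rdiag_mult_right)
  qed
  then have "V ** (W ** rdiag (f \<circ> d)) ** cadjoint U = V ** (rdiag (f \<circ> e) ** W) ** cadjoint U"
    by simp
  moreover have "V ** (W ** rdiag (f \<circ> d)) ** cadjoint U = U ** rdiag (f \<circ> d) ** cadjoint U"
    by (simp add: W_def V1 matrix_mul_assoc)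
  moreover have "V ** (rdiag (f \<circ> e) ** W) ** cadjoint U = V ** rdiag (f \<circ> e) ** cadjoint V"
    by (simp add: W_def U1 flip: matrix_mul_assoc)
  ultimately show ?thesis by simp
qed

lemma fun_calc_eq:
  assumes "unitary U" and "A = U ** rdiag d ** cadjoint U"
  shows "fun_calc f A = U ** rdiag (f \<circ> d) ** cadjoint U"
  unfolding fun_calc_def
proof (rule the_equality)
  show "\<exists>V e. unitary V \<and> A = V ** rdiag e ** cadjoint V \<and>
          U ** rdiag (f \<circ> d) ** cadjoint U = V ** rdiag (f \<circ> e) ** cadjoint V"
    using assms by blast
next
  fix M
  assume "\<exists>V e. unitary V \<and> A = V ** rdiag e ** cadjoint V \<and> M = V ** rdiag (f \<circ> e) ** cadjoint V"
  then obtain V e where V: "unitary V" "A = V ** rdiag e ** cadjoint V"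
    and M: "M = V ** rdiag (f \<circ> e) ** cadjoint V" by blast
  have "V ** rdiag e ** cadjoint V = U ** rdiag d ** cadjoint U"
    using V(2) assms(2) by simp
  then show "M = U ** rdiag (f \<circ> d) ** cadjoint U"
    unfolding M by (rule diagonalization_unique[OF V(1) assms(1)])
qed

end

theory Submission
  imports Defs
begin

text \<open>
  Diagonalizing A and B turns both sides into sums of squares over the entries of U* X V, with
  coefficients depending on one eigenvalue a of A and b of B. It then suffices to compare the
  coefficients. Put g(t) = a^(1+t) b^(1-t) + a^(1-t) b^(1+t), which is convex in t, and G(u) =
  g(u/2), u = 4\<nu>. For a, b > 0, the coefficients of the j-th summands of the two sums add up
  to the difference at u of the piecewise linear interpolants of G with mesh 2^-(j-1) and 2^-j,
  so the sums telescope; by convexity they are at most (1-4\<nu>) g(0) + 4\<nu> g(1/2) -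
  g(2\<nu>). Expanding squares, the right-hand side minus (a + b)^2 is g(1-2\<nu>) + (1-4\<nu>)
  g(0) - 2(1-2\<nu>) g(1/2), and the claim reduces to 2 g(1/2) \<le> g(2\<nu>) + g(1-2\<nu>). If
  a = 0 or b = 0, all summands vanish.
\<close>

subsection \<open>Dyadic interpolation of convex functions\<close>

text \<open>The piecewise linear interpolant of \<open>G\<close> at the multiples of 2^-m, evaluated
  at \<open>u\<close>; \<open>frac (2 ^ m * u)\<close> is the relative position of \<open>u\<close>
  in its cell.\<close>

definition dyadic_interp :: "(real \<Rightarrow> real) \<Rightarrow> nat \<Rightarrow> real \<Rightarrow> real" where
  "dyadic_interp G m u =
     (1 - frac (2 ^ m * u)) * G (of_int \<lfloor>2 ^ m * u\<rfloor> / 2 ^ m)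
     + frac (2 ^ m * u) * G ((of_int \<lfloor>2 ^ m * u\<rfloor> + 1) / 2 ^ m)"

lemma floor_double:
  fixes x :: real
  shows "\<lfloor>2 * x\<rfloor> = (if frac x < 1/2 then 2 * \<lfloor>x\<rfloor> else 2 * \<lfloor>x\<rfloor> + 1)"
  unfolding frac_def by (simp add: floor_eq_iff) linarith

lemma frac_double:
  fixes x :: real
  shows "frac (2 * x) = (if frac x < 1/2 then 2 * frac x else 2 * frac x - 1)"
  unfolding frac_def by (simp add: floor_double frac_def)

text \<open>The parity of \<open>r_idx\<close> tells which half of its cell \<open>u\<close> lies
  in, and the bracket in \<open>s_coef\<close> is the integer at the nearer end. So
  \<open>s_coef\<close> is a tent function: the distance from \<open>2 ^ m * u\<close> to the
  nearest integer.\<close>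

lemma s_coef_Suc:
  "s_coef (Suc m) u = (if frac (2 ^ m * u) < 1/2 then frac (2 ^ m * u) else 1 - frac (2 ^ m * u))"
proof -
  define x where "x = 2 ^ m * u"
  have r: "r_idx (Suc m) u = \<lfloor>2 * x\<rfloor>"
    by (simp add: r_idx_def x_def mult.assoc)
  have s: "s_coef (Suc m) u = (-1) powi \<lfloor>2 * x\<rfloor> * x
      + (-1) powi (\<lfloor>2 * x\<rfloor> + 1) * of_int \<lfloor>(of_int \<lfloor>2 * x\<rfloor> + 1) / 2 :: real\<rfloor>"
    unfolding s_coef_def r by (simp add: x_def)
  have e: "((-1) powi (2 * k) :: real) = 1" "((-1) powi (2 * k + 1) :: real) = - 1"
    "((-1) powi (2 * k + 2) :: real) = 1" for k :: int
    by (simp_all add: power_int_minus_left)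
  have f: "\<lfloor>(2 * real_of_int k + 1) / 2\<rfloor> = k" "\<lfloor>(2 * real_of_int k + 2) / 2\<rfloor> = k + 1" for k
    by (simp_all add: floor_eq_iff)
  show ?thesis
  proof (cases "frac x < 1/2")
    case True
    then have "\<lfloor>2 * x\<rfloor> = 2 * \<lfloor>x\<rfloor>" by (simp add: floor_double)
    with True show ?thesis
      unfolding s x_def[symmetric] by (simp add: e f) (simp add: frac_def)
  next
    case False
    then have "\<lfloor>2 * x\<rfloor> = 2 * \<lfloor>x\<rfloor> + 1" by (simp add: floor_double)
    with False show ?thesis
      unfolding s x_def[symmetric] by (simp add: e f add.assoc) (simp add: frac_def)
  qed
qed

lemma s_coef_Suc_nonneg: "0 \<le> s_coef (Suc m) u"
  using frac_lt_1[of "2 ^ m * u"] frac_ge_0[of "2 ^ m * u"] by (auto simp: s_coef_Suc)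

text \<open>Halving the mesh adds one node to the cell of \<open>u\<close>, its midpoint. The two
  interpolants agree at the cell ends, so they differ by a tent whose height is the gap between
  chord and \<open>G\<close> at the midpoint.\<close>

lemma dyadic_interp_refine:
  "s_coef (Suc m) u * (G (k_idx (Suc m) u / 2 ^ m) + G ((k_idx (Suc m) u + 1) / 2 ^ m)
      - 2 * G ((2 * k_idx (Suc m) u + 1) / 2 ^ Suc m))
   = dyadic_interp G m u - dyadic_interp G (Suc m) u"
proof -
  define x where "x = 2 ^ m * u"
  have x2: "2 ^ Suc m * u = 2 * x" by (simp add: x_def)
  have h: "2 * real_of_int k / 2 ^ Suc m = k / 2 ^ m"
    "(2 * real_of_int k + 2) / 2 ^ Suc m = (k + 1) / 2 ^ m" for k :: int
    by (simp_all add: field_simps)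
  have k: "k_idx (Suc m) u = \<lfloor>x\<rfloor>" by (simp add: k_idx_def x_def)
  show ?thesis
    unfolding dyadic_interp_def s_coef_Suc k x2 x_def[symmetric] floor_double frac_double
    using h[of "\<lfloor>x\<rfloor>"] by (simp add: add.assoc del: power_Suc) (simp add: algebra_simps)
qed

lemma dyadic_interp_ge:
  assumes "convex_on UNIV G"
  shows "G u \<le> dyadic_interp G m u"
proof -
  define x where "x = 2 ^ m * u"
  have "G ((1 - frac x) *\<^sub>R (of_int \<lfloor>x\<rfloor> / 2 ^ m) + frac x *\<^sub>R ((of_int \<lfloor>x\<rfloor> + 1) / 2 ^ m))
      \<le> dyadic_interp G m u"
    unfolding dyadic_interp_def x_def
    by (rule convex_onD[OF assms]) (use frac_lt_1[of "2 ^ m * u"] in \<open>auto intro: less_imp_le\<close>)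
  also have "(1 - frac x) *\<^sub>R (of_int \<lfloor>x\<rfloor> / 2 ^ m) + frac x *\<^sub>R ((of_int \<lfloor>x\<rfloor> + 1) / 2 ^ m) = x / 2 ^ m"
    by (simp add: frac_def field_simps)
  also have "\<dots> = u" by (simp add: x_def)
  finally show ?thesis .
qed

lemma dyadic_interp_0:
  assumes "0 \<le> u" "u \<le> 1"
  shows "dyadic_interp G 0 u = (1 - u) * G 0 + u * G 1"
\<comment> \<open>At u = 1 the floor selects the cell [1, 2], but with weight 0 on its right end, so
  the value is still \<open>G 1\<close>.\<close>
proof (cases "u = 1")
  case False
  with assms have "\<lfloor>u\<rfloor> = 0" by (simp add: floor_eq_iff)
  then show ?thesis by (simp add: dyadic_interp_def frac_def)
qed (simp add: dyadic_interp_def)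

lemma convex_on_midpoint:
  fixes G :: "real \<Rightarrow> real"
  assumes "convex_on UNIV G"
  shows "2 * G ((x + y) / 2) \<le> G x + G y"
  using convex_onD[OF assms, of "1/2" x y] by (simp add: add_divide_distrib)

text \<open>Each summand is the drop from one interpolant to the next finer one. The sum telescopes,
  and the finest interpolant still lies above the convex \<open>G\<close>.\<close>

lemma s_coef_sum_le:
  assumes G: "convex_on UNIV G" and "0 \<le> u" "u \<le> 1" "1 \<le> N"
  shows "(\<Sum>j=2..N. s_coef j u * (G (k_idx j u / 2 ^ (j - 1)) + G ((k_idx j u + 1) / 2 ^ (j - 1))
      - 2 * G ((2 * k_idx j u + 1) / 2 ^ j))) \<le> (1 - u) * G 0 + u * G 1 - G u"
proof -
  define T where "T j = s_coef j u * (G (k_idx j u / 2 ^ (j - 1)) + G ((k_idx j u + 1) / 2 ^ (j - 1))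
      - 2 * G ((2 * k_idx j u + 1) / 2 ^ j))" for j
  have T: "T (Suc m) = dyadic_interp G m u - dyadic_interp G (Suc m) u" for m
    using dyadic_interp_refine[of m u G] by (simp add: T_def)
  \<comment> \<open>The sum starts at j = 2, whereas telescoping from mesh 1 needs j = 1. Midpoint
    convexity makes the extra term nonnegative, so adding it is harmless.\<close>
  have "0 \<le> T (Suc 0)"
    unfolding T_def
    using convex_on_midpoint[OF G, of "k_idx (Suc 0) u" "k_idx (Suc 0) u + 1"]
    by (intro mult_nonneg_nonneg s_coef_Suc_nonneg) simp
  then have "sum T {2..N} \<le> sum T {1..N}"
    using \<open>1 \<le> N\<close> by (simp add: sum.atLeast_Suc_atMost numeral_2_eq_2)
  also have "sum T {1..N} = dyadic_interp G 0 u - dyadic_interp G N u"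
    by (induction N) (simp_all add: T)
  also have "\<dots> \<le> (1 - u) * G 0 + u * G 1 - G u"
    using dyadic_interp_ge[OF G, of u N] by (simp add: dyadic_interp_0 assms)
  finally show ?thesis by (simp add: T_def)
qed

subsection \<open>The scalar inequality\<close>

text \<open>For positive \<open>a\<close>, \<open>b\<close>: twice the Heinz mean of a^2 and b^2
  with parameter (1+t)/2, centred so that it is even in \<open>t\<close>.\<close>

definition heinz :: "real \<Rightarrow> real \<Rightarrow> real \<Rightarrow> real" where
  "heinz a b t = a powr (1 + t) * b powr (1 - t) + a powr (1 - t) * b powr (1 + t)"

text \<open>In logarithmic form this is a sum of two exponentials of affine functions of
  \<open>u\<close>, and each has an increasing derivative.\<close>

lemma convex_on_heinz:
  assumes "0 < a" "0 < b"
  shows "convex_on UNIV (\<lambda>u. heinz a b (u / 2))"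
proof -
  have e: "convex_on UNIV (\<lambda>u::real. exp (p + q * u))" for p q :: real
  proof (rule convex_on_realI[where f' = "\<lambda>u. exp (p + q * u) * q"])
    fix x y :: real
    assume "x \<le> y"
    then show "exp (p + q * x) * q \<le> exp (p + q * y) * q"
      by (auto simp: mult_le_cancel_right mult_le_cancel_left)
  qed (auto intro!: derivative_eq_intros)
  have "heinz a b (u / 2) = exp ((ln a + ln b) + (ln a - ln b) / 2 * u)
      + exp ((ln a + ln b) + (ln b - ln a) / 2 * u)" for u
  proof -
    have "(1 + u / 2) * ln a + (1 - u / 2) * ln b = (ln a + ln b) + (ln a - ln b) / 2 * u"
      "(1 - u / 2) * ln a + (1 + u / 2) * ln b = (ln a + ln b) + (ln b - ln a) / 2 * u"
      by (simp_all add: field_simps)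
    then show ?thesis
      using assms by (simp add: heinz_def powr_def flip: exp_add)
  qed
  then show ?thesis by (simp only: convex_on_add e)
qed

text \<open>The function that \<open>mpow\<close> applies to each eigenvalue, with the same
  convention at exponent 0.\<close>

definition rpow :: "real \<Rightarrow> real \<Rightarrow> real" where
  "rpow x t = (if t = 0 then 1 else x powr t)"

lemma rpow_pos: "0 < x \<Longrightarrow> rpow x t = x powr t"
  by (simp add: rpow_def)

lemma rpow_0_left: "t \<noteq> 0 \<Longrightarrow> rpow 0 t = 0"
  by (simp add: rpow_def)

text \<open>The exponents of the mixed term are the midpoints of those of the two squares; this is
  the source of the second differences of \<open>heinz\<close>.\<close>

lemma powr_diff_square:
  fixes a b :: real
  assumes "0 < a" "0 < b"
  shows "(a powr p * b powr q - a powr p' * b powr q')\<^sup>2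
       = a powr (2 * p) * b powr (2 * q) + a powr (2 * p') * b powr (2 * q')
         - 2 * (a powr (p + p') * b powr (q + q'))"
proof -
  have sq: "(x powr t)\<^sup>2 = x powr (2 * t)" if "0 < x" for x t :: real
    using that by (simp add: powr_power mult.commute)
  show ?thesis
    unfolding power2_diff power_mult_distrib sq[OF assms(1)] sq[OF assms(2)] powr_add by simp
qed

text \<open>Keeps the exponents 1/2 + x and 1/2 - x in the sums strictly positive, so that 0^0 never
  occurs there. For j = 1 and u = 1 the second quotient would equal 1/2.\<close>

lemma k_idx_bounds:
  assumes "2 \<le> j" "0 \<le> u" "u \<le> 1"
  shows "0 \<le> k_idx j u / 2 ^ (j + 1)" "(k_idx j u + 1) / 2 ^ (j + 1) < (1/2 :: real)"
proof -
  have "0 \<le> k_idx j u" using assms by (simp add: k_idx_def)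
  then show "0 \<le> k_idx j u / 2 ^ (j + 1)" by simp
  obtain i where j: "j = Suc (Suc i)" using assms by (metis add_2_eq_Suc le_Suc_ex)
  have "real_of_int (k_idx j u) \<le> 2 ^ Suc i * u" unfolding k_idx_def j by simp
  also have "\<dots> \<le> 2 ^ Suc i" using assms by (simp add: mult_left_le)
  finally have "real_of_int (k_idx j u) \<le> 2 * 2 ^ i" by simp
  then have "real_of_int (k_idx j u) + 1 < 4 * 2 ^ i"
    using one_le_power[of "2::real" i] by linarith
  then show "(k_idx j u + 1) / 2 ^ (j + 1) < (1/2 :: real)"
    by (simp add: j divide_less_eq)
qed

lemma scalar_inequality_pos:
  fixes a b \<nu> :: real
  assumes "0 < a" "0 < b" "N \<ge> 2" "0 \<le> \<nu>" "\<nu> \<le> 1/4"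
  shows "(a + b)\<^sup>2
    + (\<Sum>j=2..N. s_coef j (4*\<nu>) *
        (a powr (1/2 + k_idx j (4*\<nu>) / 2^(j+1)) * b powr (1/2 - k_idx j (4*\<nu>) / 2^(j+1))
         - a powr (1/2 + (k_idx j (4*\<nu>) + 1) / 2^(j+1)) * b powr (1/2 - (k_idx j (4*\<nu>) + 1) / 2^(j+1)))\<^sup>2)
    + (\<Sum>j=2..N. s_coef j (4*\<nu>) *
        (a powr (1/2 - k_idx j (4*\<nu>) / 2^(j+1)) * b powr (1/2 + k_idx j (4*\<nu>) / 2^(j+1))
         - a powr (1/2 - (k_idx j (4*\<nu>) + 1) / 2^(j+1)) * b powr (1/2 + (k_idx j (4*\<nu>) + 1) / 2^(j+1)))\<^sup>2)
    \<le> (a powr \<nu> * b powr (1 - \<nu>) + a powr (1 - \<nu>) * b powr \<nu>)\<^sup>2 + 2 * \<nu> * (a - b)\<^sup>2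
      + (1 - 2*\<nu>) * ((a powr (1/2) * b powr (1/2) - a)\<^sup>2 + (a powr (1/2) * b powr (1/2) - b)\<^sup>2)"
    (is "_ + ?S1 + ?S2 \<le> ?R1 + _ + _ * ?R3")
proof -
  let ?u = "4 * \<nu>"
  define G where "G = (\<lambda>u. heinz a b (u / 2))"
  have G: "convex_on UNIV G" unfolding G_def by (rule convex_on_heinz) fact+
  note sq = powr_diff_square[OF assms(1,2)]
  have step: "(a powr (1/2 + k / 2^(j+1)) * b powr (1/2 - k / 2^(j+1))
         - a powr (1/2 + (k + 1) / 2^(j+1)) * b powr (1/2 - (k + 1) / 2^(j+1)))\<^sup>2
      + (a powr (1/2 - k / 2^(j+1)) * b powr (1/2 + k / 2^(j+1))
         - a powr (1/2 - (k + 1) / 2^(j+1)) * b powr (1/2 + (k + 1) / 2^(j+1)))\<^sup>2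
      = G (k / 2 ^ (j - 1)) + G ((k + 1) / 2 ^ (j - 1)) - 2 * G ((2 * k + 1) / 2 ^ j)"
    if "1 \<le> j" for j and k :: real
  proof -
    obtain i where j: "j = Suc i" using \<open>1 \<le> j\<close> by (cases j) auto
    \<comment> \<open>Squaring doubles the offsets \<open>x\<close> and \<open>y\<close>. As 2x is
      half of k / 2^(j-1), the argument u/2 in \<open>G\<close> puts the squares at the dyadic nodes
      and the mixed terms at their midpoint.\<close>
    define x y where "x = k / 2 ^ (j + 1)" and "y = (k + 1) / 2 ^ (j + 1)"
    have e: "k / 2 ^ (j - 1) / 2 = 2 * x" "(k + 1) / 2 ^ (j - 1) / 2 = 2 * y"
      "(2 * k + 1) / 2 ^ j / 2 = x + y"
      by (simp_all add: j x_def y_def field_simps)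
    show ?thesis
      unfolding G_def e heinz_def sq x_def[symmetric] y_def[symmetric] by (simp add: algebra_simps)
  qed
  have "?S1 + ?S2 = (\<Sum>j=2..N. s_coef j ?u * (G (k_idx j ?u / 2 ^ (j - 1))
      + G ((k_idx j ?u + 1) / 2 ^ (j - 1)) - 2 * G ((2 * k_idx j ?u + 1) / 2 ^ j)))"
    unfolding sum.distrib[symmetric] distrib_left[symmetric]
  proof (intro sum.cong refl arg_cong2[where f = "(*)"])
    fix j assume "j \<in> {2..N}"
    then show "(a powr (1/2 + k_idx j ?u / 2^(j+1)) * b powr (1/2 - k_idx j ?u / 2^(j+1))
         - a powr (1/2 + (k_idx j ?u + 1) / 2^(j+1)) * b powr (1/2 - (k_idx j ?u + 1) / 2^(j+1)))\<^sup>2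
      + (a powr (1/2 - k_idx j ?u / 2^(j+1)) * b powr (1/2 + k_idx j ?u / 2^(j+1))
         - a powr (1/2 - (k_idx j ?u + 1) / 2^(j+1)) * b powr (1/2 + (k_idx j ?u + 1) / 2^(j+1)))\<^sup>2
      = G (k_idx j ?u / 2 ^ (j - 1)) + G ((k_idx j ?u + 1) / 2 ^ (j - 1)) - 2 * G ((2 * k_idx j ?u + 1) / 2 ^ j)"
      using step[of j "k_idx j ?u"] by simp
  qed
  also have "\<dots> \<le> (1 - ?u) * G 0 + ?u * G 1 - G ?u"
    by (rule s_coef_sum_le) (use assms G in auto)
  finally have S: "?S1 + ?S2 \<le> (1 - ?u) * G 0 + ?u * G 1 - G ?u" .
  have R1: "?R1 = G (2 - ?u) + G 0"
  proof -
    \<comment> \<open>Trading the sum for a difference makes \<open>powr_diff_square\<close>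
      applicable; the mixed terms then leave 2ab, which is \<open>G 0\<close>.\<close>
    have plus: "(x + y)\<^sup>2 = (x - y)\<^sup>2 + 4 * (x * y)" for x y :: real
      by (simp add: power2_eq_square algebra_simps)
    have e: "1 - (2 - ?u) / 2 = 2 * \<nu>" "1 + (2 - ?u) / 2 = 2 * (1 - \<nu>)"
      by (simp_all add: field_simps)
    have m: "a powr \<nu> * b powr (1 - \<nu>) * (a powr (1 - \<nu>) * b powr \<nu>) = a * b"
      using assms(1,2) by (simp add: powr_diff)
    show ?thesis
      unfolding plus sq m G_def heinz_def e using assms(1,2) by (simp add: algebra_simps)
  qed
  have R3: "?R3 = G 0 + G 2 - 2 * G 1"
  proof -
    have "(a powr (1/2) * b powr (1/2) - a)\<^sup>2 = (a powr (1/2) * b powr (1/2) - a powr 1 * b powr 0)\<^sup>2"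
      "(a powr (1/2) * b powr (1/2) - b)\<^sup>2 = (a powr (1/2) * b powr (1/2) - a powr 0 * b powr 1)\<^sup>2"
      using assms(1,2) by simp_all
    then show ?thesis
      unfolding sq using assms(1,2) by (simp add: G_def heinz_def)
  qed
  have mid: "2 * G 1 \<le> G (2 - ?u) + G ?u"
    using convex_on_midpoint[OF G, of "2 - ?u" ?u] by simp
  have ab: "(a + b)\<^sup>2 = G 2 + G 0" "(a - b)\<^sup>2 = G 2 - G 0"
    using assms(1,2) by (simp_all add: G_def heinz_def power2_eq_square algebra_simps)
  \<comment> \<open>After inserting the bound on \<open>s\<close>, all multiples of
    \<open>G 0\<close> and \<open>G 2\<close> cancel, and what remains is exactly
    \<open>mid\<close>.\<close>
  have "(G 2 + G 0) + s \<le> (G (2 - ?u) + G 0) + 2 * \<nu> * (G 2 - G 0)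
      + (1 - 2*\<nu>) * (G 0 + G 2 - 2 * G 1)"
    if "s \<le> (1 - ?u) * G 0 + ?u * G 1 - G ?u" for s
    using that mid by (simp add: algebra_simps)
  from this[OF S] show ?thesis
    unfolding R1 R3 ab by (simp only: add.assoc)
qed

lemma scalar_inequality:
  fixes a b \<nu> :: real
  assumes "0 \<le> a" "0 \<le> b" "N \<ge> 2" "0 \<le> \<nu>" "\<nu> \<le> 1/4"
  shows "(a + b)\<^sup>2
    + (\<Sum>j=2..N. s_coef j (4*\<nu>) *
        (rpow a (1/2 + k_idx j (4*\<nu>) / 2^(j+1)) * rpow b (1/2 - k_idx j (4*\<nu>) / 2^(j+1))
         - rpow a (1/2 + (k_idx j (4*\<nu>) + 1) / 2^(j+1)) * rpow b (1/2 - (k_idx j (4*\<nu>) + 1) / 2^(j+1)))\<^sup>2)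
    + (\<Sum>j=2..N. s_coef j (4*\<nu>) *
        (rpow a (1/2 - k_idx j (4*\<nu>) / 2^(j+1)) * rpow b (1/2 + k_idx j (4*\<nu>) / 2^(j+1))
         - rpow a (1/2 - (k_idx j (4*\<nu>) + 1) / 2^(j+1)) * rpow b (1/2 + (k_idx j (4*\<nu>) + 1) / 2^(j+1)))\<^sup>2)
    \<le> (rpow a \<nu> * rpow b (1 - \<nu>) + rpow a (1 - \<nu>) * rpow b \<nu>)\<^sup>2 + 2 * \<nu> * (a - b)\<^sup>2
      + (1 - 2*\<nu>) * ((rpow a (1/2) * rpow b (1/2) - a)\<^sup>2 + (rpow a (1/2) * rpow b (1/2) - b)\<^sup>2)"
    (is "_ + ?S1 + ?S2 \<le> ?R1 + _ + _ * ?R3")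
proof (cases "0 < a \<and> 0 < b")
  case True
  then show ?thesis using scalar_inequality_pos[of a b N \<nu>] assms by (simp only: rpow_pos)
next
  case False
  then have 0: "a = 0 \<or> b = 0" using assms by auto
  have z: "rpow a s * rpow b t = 0" if "0 < s" "0 < t" for s t
    using 0 that by (auto simp: rpow_0_left)
  have zero: "rpow a (1/2 + x) * rpow b (1/2 - x) = 0" "rpow a (1/2 - x) * rpow b (1/2 + x) = 0"
    if "- 1/2 < x" "x < 1/2" for x
    by (rule z; use that in linarith)+
  have kb: "- 1/2 < k_idx j (4*\<nu>) / 2^(j+1)" "k_idx j (4*\<nu>) / 2^(j+1) < (1/2 :: real)"
    "- 1/2 < (k_idx j (4*\<nu>) + 1) / 2^(j+1)" "(k_idx j (4*\<nu>) + 1) / 2^(j+1) < (1/2 :: real)" if "2 \<le> j" for j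
  proof -
    have "k_idx j (4*\<nu>) / 2^(j+1) \<le> (k_idx j (4*\<nu>) + 1) / (2^(j+1) :: real)"
      by (simp add: divide_right_mono)
    then show "- 1/2 < k_idx j (4*\<nu>) / 2^(j+1)" "k_idx j (4*\<nu>) / 2^(j+1) < (1/2 :: real)"
      "- 1/2 < (k_idx j (4*\<nu>) + 1) / 2^(j+1)" "(k_idx j (4*\<nu>) + 1) / 2^(j+1) < (1/2 :: real)"
      using k_idx_bounds[OF that, of "4*\<nu>"] assms by linarith+
  qed
  have "?S1 = 0" "?S2 = 0"
    by (intro sum.neutral ballI; simp only: zero[OF kb(1,2)] zero[OF kb(3,4)] atLeastAtMost_iff; simp)+
  moreover have "?R3 = a\<^sup>2 + b\<^sup>2" by (simp add: z)
  \<comment> \<open>With a zero eigenvalue, (a+b)^2 and (a-b)^2 both equal a^2 + b^2, so equality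
    holds at r = 0. Here \<open>r\<close> stands for \<open>?R1\<close>, which can be nonzero at
    \<nu> = 0 because \<open>rpow 0 0 = 1\<close>.\<close>
  moreover have "(a + b)\<^sup>2 \<le> r + 2 * \<nu> * (a - b)\<^sup>2 + (1 - 2*\<nu>) * (a\<^sup>2 + b\<^sup>2)" if "0 \<le> r" for r
    using 0 that by (auto simp: algebra_simps)
  ultimately show ?thesis by simp
qed

subsection \<open>The spectral theorem for Hermitian matrices\<close>

definition cdot :: "complex^'n \<Rightarrow> complex^'n \<Rightarrow> complex" where
  "cdot x y = (\<Sum>i\<in>UNIV. cnj (x $ i) * y $ i)"

lemma Re_cdot: "Re (cdot x y) = x \<bullet> y"
  by (simp add: cdot_def inner_vec_def inner_complex_def)

lemma Im_cdot: "Im (cdot x y) = (\<i> *s x) \<bullet> y"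
  by (simp add: cdot_def inner_vec_def inner_complex_def algebra_simps)

text \<open>Complex orthogonality becomes two real conditions, which opens the way to the Euclidean
  structure of \<open>complex^'n\<close>.\<close>

lemma cdot_eq_0_iff: "cdot x y = 0 \<longleftrightarrow> x \<bullet> y = 0 \<and> (\<i> *s x) \<bullet> y = 0"
  by (simp add: complex_eq_iff Re_cdot Im_cdot)

lemma cdot_self: "cdot x x = of_real ((norm x)\<^sup>2)"
proof -
  have "Im (cdot x x) = 0" by (simp add: cdot_def)
  then show ?thesis by (simp add: complex_eq_iff Re_cdot power2_norm_eq_inner)
qed

lemma cdot_commute: "cdot y x = cnj (cdot x y)"
  by (simp add: cdot_def mult.commute)

lemma cdot_scaleR_left: "cdot (r *\<^sub>R x) y = of_real r * cdot x y"
  by (simp add: cdot_def scaleR_sum_right flip: scaleR_conv_of_real)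

lemma cdot_hermitian:
  assumes "cadjoint A = A"
  shows "cdot x (A *v y) = cdot (A *v x) y"
proof -
  have A: "cnj (A $ i $ j) = A $ j $ i" for i j
    using arg_cong[OF assms, of "\<lambda>M. M $ j $ i"] by (simp add: cadjoint_def)
  have "cdot x (A *v y) = (\<Sum>i\<in>UNIV. \<Sum>j\<in>UNIV. cnj (x $ i) * (A $ i $ j * y $ j))"
    by (simp add: cdot_def matrix_vector_mult_def sum_distrib_left)
  also have "\<dots> = (\<Sum>j\<in>UNIV. \<Sum>i\<in>UNIV. cnj (x $ i) * (A $ i $ j * y $ j))"
    by (rule sum.swap)
  also have "\<dots> = cdot (A *v x) y"
    by (simp add: cdot_def matrix_vector_mult_def sum_distrib_left sum_distrib_right A mult_ac)
  finally show ?thesis .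
qed

lemma linear_matrix_vector_complex: "linear ((*v) (A :: complex^'n^'m))"
  by (rule linearI)
    (simp_all add: vec_eq_iff matrix_vector_mult_def scaleR_sum_right distrib_left sum.distrib)

text \<open>A real dimension count: \<open>S\<close> together with its multiples by \<i> has at most
  2 \<open>card S\<close> elements, fewer than the real dimension of
  \<open>complex^'n\<close>.\<close>

lemma exists_cdot_orthogonal:
  fixes S :: "(complex^'n) set"
  assumes "finite S" "card S < CARD('n)"
  obtains x where "x \<noteq> 0" "\<And>s. s \<in> S \<Longrightarrow> cdot s x = 0"
proof -
  let ?T = "S \<union> (*s) \<i> ` S"
  have "dim (span ?T) \<le> card ?T"
    using assms(1) by (simp add: dim_span dim_le_card')
  also have "\<dots> \<le> card S + card S"
    by (rule order_trans[OF card_Un_le]) (simp add: card_image_le assms(1))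
  also have "\<dots> < DIM(complex^'n)"
    using assms(2) by simp
  finally obtain x where "x \<noteq> 0" and x: "\<And>y. y \<in> span (span ?T) \<Longrightarrow> orthogonal x y"
    by (metis dim_span orthogonal_to_subspace_exists)
  show ?thesis
  proof (rule that[OF \<open>x \<noteq> 0\<close>])
    fix s assume "s \<in> S"
    then have "orthogonal x s" "orthogonal x (\<i> *s s)"
      by (auto intro!: x span_base)
    then show "cdot s x = 0"
      by (simp add: cdot_eq_0_iff orthogonal_def inner_commute)
  qed
qed

(* The eigenvector maximizes the Rayleigh quotient on the unit sphere of the orthogonal
   complement W of S; the first-order condition is taken in the direction of the residual
   A x - c x, which lies in W because S consists of eigenvectors. *)
lemma hermitian_eigenvector_orthogonal:
  fixes A :: "complex^'n^'n"
  assumes A: "cadjoint A = A" and S: "finite S" "card S < CARD('n)"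
    and eig: "\<And>s. s \<in> S \<Longrightarrow> \<exists>c::real. A *v s = c *\<^sub>R s"
  obtains x and c :: real where "norm x = 1" "A *v x = c *\<^sub>R x" "\<And>s. s \<in> S \<Longrightarrow> cdot s x = 0"
proof -
  define W where "W = {x. \<forall>s\<in>S. cdot s x = 0}"
  define f where "f x = x \<bullet> (A *v x)" for x
  have W_add: "x + y \<in> W" and W_scale: "r *\<^sub>R x \<in> W" and W_A: "A *v x \<in> W"
    if "x \<in> W" "y \<in> W" for x y r
  proof -
    show "x + y \<in> W" "r *\<^sub>R x \<in> W"
      using that by (auto simp: W_def cdot_eq_0_iff inner_add_right)
    have "cdot s (A *v x) = 0" if "s \<in> S" for s
      using eig[OF that] \<open>x \<in> W\<close> that by (auto simp: cdot_hermitian[OF A] cdot_scaleR_left W_def)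
    then show "A *v x \<in> W" by (simp add: W_def)
  qed
  have lin: "linear ((*v) A)" by (rule linear_matrix_vector_complex)
  have self_adj: "x \<bullet> (A *v y) = (A *v x) \<bullet> y" for x y
    using cdot_hermitian[OF A] by (simp flip: Re_cdot)
  have f_scale: "f (r *\<^sub>R x) = r\<^sup>2 * f x" for r x
    by (simp add: f_def linear_scale[OF lin] power2_eq_square)
  have "closed W"
    unfolding W_def cdot_eq_0_iff Ball_def
    by (intro closed_Collect_all closed_Collect_imp closed_Collect_conj closed_Collect_eq
        continuous_intros open_Collect_const)
  then have "compact (sphere 0 1 \<inter> W)" by (intro compact_Int_closed compact_sphere)
  moreover obtain w where w: "w \<noteq> 0" "\<And>s. s \<in> S \<Longrightarrow> cdot s w = 0"
    by (rule exists_cdot_orthogonal[OF S]) blast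
  then have "w \<in> W" by (simp add: W_def)
  with w have "w /\<^sub>R norm w \<in> sphere 0 1 \<inter> W"
    using W_scale[of w w] by simp
  then have "sphere 0 1 \<inter> W \<noteq> {}" by blast
  moreover have "continuous_on (sphere 0 1 \<inter> W) f"
    unfolding f_def
    by (intro continuous_intros linear_continuous_on linear_conv_bounded_linear[THEN iffD1] lin)
  ultimately obtain x where x: "norm x = 1" "x \<in> W"
    and max: "\<And>y. norm y = 1 \<Longrightarrow> y \<in> W \<Longrightarrow> f y \<le> f x"
    by (metis (no_types, lifting) IntE IntI continuous_attains_sup mem_sphere_0)
  \<comment> \<open>Homogeneity of degree 2 carries the maximum from the unit sphere to all of
    \<open>W\<close>.\<close>
  have bound: "f y \<le> f x * (norm y)\<^sup>2" if "y \<in> W" for y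
  proof (cases "y = 0")
    case False
    have "f (y /\<^sub>R norm y) \<le> f x"
      using False that W_scale[of y y] by (intro max) auto
    then show ?thesis
      using False by (simp add: f_scale field_simps)
  qed (simp add: f_def)
  define y where "y = A *v x - f x *\<^sub>R x"
  have "y = A *v x + (- f x) *\<^sub>R x" by (simp add: y_def)
  then have yW: "y \<in> W" using x(2) W_add W_scale W_A by metis
  have xy: "x \<bullet> y = 0"
    using x(1) by (simp add: y_def inner_diff_right f_def flip: power2_norm_eq_inner)
  have yy: "x \<bullet> (A *v y) = (norm y)\<^sup>2"
  proof -
    have "(norm y)\<^sup>2 = (A *v x) \<bullet> y - f x * (x \<bullet> y)"
      by (simp add: power2_norm_eq_inner y_def inner_diff_left)
    then show ?thesis by (simp add: xy self_adj)
  qed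
  define M where "M = f x * (norm y)\<^sup>2 - f y"
  \<comment> \<open>\<open>bound\<close> at x + t y: the terms \<open>f x\<close> cancel, leaving a
    linear term in \<open>t\<close> against a quadratic one.\<close>
  have le: "2 * t * (norm y)\<^sup>2 \<le> t\<^sup>2 * M" for t
  proof -
    have "f (x + t *\<^sub>R y) = f x + 2 * t * (norm y)\<^sup>2 + t\<^sup>2 * f y"
      using yy self_adj[of y x]
      by (simp add: f_def linear_add[OF lin] linear_scale[OF lin] inner_add_left inner_add_right
          power2_eq_square inner_commute algebra_simps)
    moreover have "(norm (x + t *\<^sub>R y))\<^sup>2 = 1 + t\<^sup>2 * (norm y)\<^sup>2"
      using xy x(1) unfolding power2_norm_eq_inner
      by (simp add: inner_add_left inner_add_right inner_commute power2_eq_square norm_eq_1)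
    moreover have "x + t *\<^sub>R y \<in> W" using x(2) yW W_add W_scale by metis
    ultimately show ?thesis
      using bound[of "x + t *\<^sub>R y"] by (simp add: M_def algebra_simps)
  qed
  have "(norm y)\<^sup>2 \<le> 0"
  proof (rule ccontr)
    assume "\<not> (norm y)\<^sup>2 \<le> 0"
    then have y0: "0 < (norm y)\<^sup>2" by simp
    moreover have "2 * (norm y)\<^sup>2 \<le> M" using le[of 1] by simp
    ultimately have "0 < M" by linarith
    \<comment> \<open>With t = |y|^2 / M the quadratic side equals half of the linear side, which is
      positive.\<close>
    have "2 * ((norm y)\<^sup>2 / M) * (norm y)\<^sup>2 \<le> ((norm y)\<^sup>2 / M) * (norm y)\<^sup>2"
      using le[of "(norm y)\<^sup>2 / M"] \<open>0 < M\<close> by (simp add: power2_eq_square)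
    moreover have "0 < ((norm y)\<^sup>2 / M) * (norm y)\<^sup>2"
      using y0 \<open>0 < M\<close> by (intro mult_pos_pos divide_pos_pos)
    ultimately show False by linarith
  qed
  then have "y = 0" by simp
  then show ?thesis
    using that[of x "f x"] x by (simp add: y_def W_def)
qed

text \<open>Induction on \<open>k\<close>: as long as fewer than n eigenvectors are present, their
  orthogonal complement supplies a further one.\<close>

lemma hermitian_orthonormal_eigenvectors:
  fixes A :: "complex^'n^'n"
  assumes "cadjoint A = A" and "k \<le> CARD('n)"
  shows "\<exists>S. finite S \<and> card S = k \<and> (\<forall>s\<in>S. norm s = 1 \<and> (\<exists>c::real. A *v s = c *\<^sub>R s))
           \<and> (\<forall>s\<in>S. \<forall>t\<in>S. s \<noteq> t \<longrightarrow> cdot s t = 0)"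
  using assms(2)
proof (induction k)
  case 0
  show ?case by (rule exI[of _ "{}"]) simp
next
  case (Suc k)
  then obtain S where S: "finite S" "card S = k"
    "\<forall>s\<in>S. norm s = 1 \<and> (\<exists>c::real. A *v s = c *\<^sub>R s)"
    "\<forall>s\<in>S. \<forall>t\<in>S. s \<noteq> t \<longrightarrow> cdot s t = 0" by auto
  obtain x and c :: real
    where x: "norm x = 1" "A *v x = c *\<^sub>R x" "\<And>s. s \<in> S \<Longrightarrow> cdot s x = 0"
  proof (rule hermitian_eigenvector_orthogonal[OF assms(1) S(1)])
    show "card S < CARD('n)" using S(2) Suc.prems by simp
    show "\<exists>c::real. A *v s = c *\<^sub>R s" if "s \<in> S" for s using S(3) that by blast
  qed blast
  have "x \<notin> S" using x(1) x(3)[of x] by (auto simp: cdot_self)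
  moreover have "cdot x s = 0" if "s \<in> S" for s
    using x(3)[OF that] by (simp add: cdot_commute[of x])
  ultimately show ?case
    using S x by (intro exI[of _ "insert x S"]) auto
qed

lemma hermitian_diagonalization:
  fixes A :: "complex^'n^'n"
  assumes "cadjoint A = A"
  obtains U d where "unitary U" "A = U ** rdiag d ** cadjoint U"
proof -
  obtain S where S: "finite S" "card S = CARD('n)"
    "\<forall>s\<in>S. norm s = 1 \<and> (\<exists>c::real. A *v s = c *\<^sub>R s)"
    "\<forall>s\<in>S. \<forall>t\<in>S. s \<noteq> t \<longrightarrow> cdot s t = 0"
    using hermitian_orthonormal_eigenvectors[OF assms order_refl] by blast
  \<comment> \<open>Indexing the eigenvectors by \<open>'n\<close> lets them serve as the columns of
    \<open>U\<close>.\<close>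
  obtain e :: "'n \<Rightarrow> _" where e: "bij_betw e UNIV S"
    using finite_same_card_bij[OF _ S(1)] S(2) by (metis finite_class.finite_UNIV)
  then have eS: "e i \<in> S" for i by (auto simp: bij_betw_def)
  have "\<forall>i. \<exists>c::real. A *v e i = c *\<^sub>R e i" using S(3) eS by blast
  then obtain d :: "'n \<Rightarrow> real" where d: "\<And>i. A *v e i = d i *\<^sub>R e i" by metis
  have orth: "cdot (e i) (e j) = (if i = j then 1 else 0)" for i j
    using S(3,4) eS bij_betw_imp_inj_on[OF e] by (auto simp: cdot_self inj_eq)
  define U :: "complex^'n^'n" where "U = (\<chi> i j. e j $ i)"
  have 1: "cadjoint U ** U = mat 1"
    using orth by (simp add: vec_eq_iff matrix_matrix_mult_def cadjoint_def U_def mat_def cdot_def)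
  then have 2: "U ** cadjoint U = mat 1"
    by (simp add: matrix_left_right_inverse)
  have "A ** U = U ** rdiag d"
  proof -
    have "(A ** U) $ i $ j = (U ** rdiag d) $ i $ j" for i j
      using arg_cong[OF d[of j], of "\<lambda>v. v $ i"] unfolding rdiag_mult_right
      by (simp add: matrix_matrix_mult_def matrix_vector_mult_def U_def)
        (simp add: scaleR_conv_of_real mult.commute)
    then show ?thesis by (simp add: vec_eq_iff)
  qed
  then have "A = U ** rdiag d ** cadjoint U"
    by (metis 2 matrix_mul_assoc matrix_mul_rid)
  with 1 2 show ?thesis by (intro that[of U d]) (simp_all add: unitary_def)
qed

text \<open>Each eigenvalue is the quadratic form of \<open>A\<close> at a unit column of
  \<open>U\<close>, hence nonnegative.\<close>

lemma psd_diagonalization: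
  fixes A :: "complex^'n^'n"
  assumes "psd A"
  obtains U d where "unitary U" "A = U ** rdiag d ** cadjoint U" "\<And>i. 0 \<le> d i"
proof -
  have "cadjoint A = A" using assms by (simp add: psd_def)
  then obtain U d where U: "unitary U" "A = U ** rdiag d ** cadjoint U"
    by (rule hermitian_diagonalization)
  have inv: "cadjoint U ** U = mat 1" using U(1) by (simp add: unitary_def)
  have "0 \<le> d i" for i
  proof -
    have "A *v column i U = column i (A ** U)"
      by (simp add: vec_eq_iff column_def matrix_matrix_mult_def matrix_vector_mult_def)
    also have "A ** U = U ** rdiag d"
      using inv by (simp add: U(2) flip: matrix_mul_assoc)
    also have "column i \<dots> = d i *\<^sub>R column i U"
      by (simp add: vec_eq_iff column_def rdiag_mult_right) (simp add: scaleR_conv_of_real mult.commute)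
    finally have "Re (cdot (column i U) (A *v column i U)) = d i * (column i U \<bullet> column i U)"
      by (simp add: Re_cdot)
    moreover have "cdot (column i U) (column i U) = 1"
      using arg_cong[OF inv, of "\<lambda>M. M $ i $ i"]
      by (simp add: matrix_matrix_mult_def cadjoint_def cdot_def column_def mat_def)
    then have "column i U \<bullet> column i U = 1" by (simp flip: Re_cdot)
    moreover have "0 \<le> Re (cdot (column i U) (A *v column i U))"
      using assms by (simp add: psd_def cdot_def)
    ultimately show ?thesis by simp
  qed
  with U that show ?thesis by blast
qed

subsection \<open>Hilbert-Schmidt norms in eigenbases\<close>

lemma cadjoint_cadjoint [simp]: "cadjoint (cadjoint A) = A"
  by (simp add: cadjoint_def vec_eq_iff)

lemma cadjoint_mult: "cadjoint (A ** B) = cadjoint B ** cadjoint A"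
  by (simp add: cadjoint_def vec_eq_iff matrix_matrix_mult_def mult.commute)

text \<open>In trace form, invariance under adjoints is the cyclicity of the trace, and invariance
  under \<open>U\<close> is the cancellation of \<open>cadjoint U ** U\<close>.\<close>

lemma norm_square_eq_trace:
  fixes M :: "complex^'n^'m"
  shows "complex_of_real ((norm M)\<^sup>2) = trace (cadjoint M ** M)"
proof -
  have "(norm M)\<^sup>2 = (\<Sum>i\<in>UNIV. \<Sum>j\<in>UNIV. (cmod (M $ i $ j))\<^sup>2)"
    by (simp add: norm_eq_hilbert_schmidt sum_nonneg)
  also have "complex_of_real \<dots> = (\<Sum>j\<in>UNIV. \<Sum>i\<in>UNIV. cnj (M $ i $ j) * M $ i $ j)"
    unfolding of_real_sum by (subst sum.swap) (simp only: complex_norm_square mult.commute)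
  also have "\<dots> = trace (cadjoint M ** M)"
    by (simp add: trace_def matrix_matrix_mult_def cadjoint_def)
  finally show ?thesis .
qed

lemma norm_cadjoint: "norm (cadjoint M) = norm M"
proof -
  have "complex_of_real ((norm (cadjoint M))\<^sup>2) = complex_of_real ((norm M)\<^sup>2)"
    unfolding norm_square_eq_trace cadjoint_cadjoint by (rule trace_mul_sym)
  then show ?thesis by (simp only: of_real_eq_iff) simp
qed

lemma norm_unitary_mult:
  assumes "unitary U"
  shows "norm (U ** M) = norm M"
proof -
  have "cadjoint (U ** M) ** (U ** M) = cadjoint M ** (cadjoint U ** U) ** M"
    by (simp add: cadjoint_mult matrix_mul_assoc)
  also have "\<dots> = cadjoint M ** M"
    using assms by (simp add: unitary_def)
  finally have "complex_of_real ((norm (U ** M))\<^sup>2) = complex_of_real ((norm M)\<^sup>2)"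
    by (simp only: norm_square_eq_trace)
  then show ?thesis by (simp only: of_real_eq_iff) simp
qed

lemma norm_mult_cadjoint_unitary:
  assumes "unitary V"
  shows "norm (M ** cadjoint V) = norm M"
  using norm_unitary_mult[OF assms, of "cadjoint M"] norm_cadjoint[of "M ** cadjoint V"]
  by (simp add: cadjoint_mult norm_cadjoint)

section \<open>Entrywise multipliers between two eigenbases\<close>

definition schur_mult :: "('m \<Rightarrow> 'n \<Rightarrow> real) \<Rightarrow> complex^'n^'m \<Rightarrow> complex^'n^'m" where
  "schur_mult c Y = (\<chi> i j. complex_of_real (c i j) * Y $ i $ j)"

text \<open>Common form of all matrices inside the norms of the theorem: adding or subtracting them
  only changes the multiplier \<open>c\<close>.\<close>

definition schur_conj :: "complex^'n^'n \<Rightarrow> complex^'n^'n \<Rightarrow> complex^'n^'n \<Rightarrow> ('n \<Rightarrow> 'n \<Rightarrow> real) \<Rightarrow> complex^'n^'n" where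
  "schur_conj U V X c = U ** schur_mult c (cadjoint U ** X ** V) ** cadjoint V"

definition weighted_sum :: "complex^'n^'m \<Rightarrow> ('m \<Rightarrow> 'n \<Rightarrow> real) \<Rightarrow> real" where
  "weighted_sum Y c = (\<Sum>i\<in>UNIV. \<Sum>j\<in>UNIV. c i j * (cmod (Y $ i $ j))\<^sup>2)"

lemma matrix_add_rdistrib: "(A + B) ** C = A ** C + B ** (C :: 'a::semiring_1^'n^'m)"
  by (simp add: vec_eq_iff matrix_matrix_mult_def distrib_right sum.distrib)

lemma schur_conj_add: "schur_conj U V X c + schur_conj U V X c' = schur_conj U V X (\<lambda>i j. c i j + c' i j)"
proof -
  have "schur_mult (\<lambda>i j. c i j + c' i j) Y = schur_mult c Y + schur_mult c' Y" for Y :: "complex^'a^'a"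
    by (simp add: schur_mult_def vec_eq_iff algebra_simps)
  then show ?thesis
    by (simp add: schur_conj_def matrix_add_ldistrib matrix_add_rdistrib)
qed

lemma schur_conj_diff: "schur_conj U V X c - schur_conj U V X c' = schur_conj U V X (\<lambda>i j. c i j - c' i j)"
  using schur_conj_add[of U V X "\<lambda>i j. c i j - c' i j" c'] by (simp add: algebra_simps)

lemma norm_schur_conj:
  assumes "unitary U" "unitary V"
  shows "(norm (schur_conj U V X c))\<^sup>2 = weighted_sum (cadjoint U ** X ** V) (\<lambda>i j. (c i j)\<^sup>2)"
proof -
  have "norm (schur_conj U V X c) = norm (schur_mult c (cadjoint U ** X ** V))"
    by (simp add: schur_conj_def norm_mult_cadjoint_unitary norm_unitary_mult assms)
  then show ?thesis
    by (simp add: norm_eq_hilbert_schmidt sum_nonneg schur_mult_def weighted_sum_def norm_mult power_mult_distrib)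
qed

text \<open>In the eigenbases, diagonal factors on the left and right scale row i by
  \<open>p i\<close> and column j by \<open>q j\<close>.\<close>

lemma conj_rdiag_mult_conj_rdiag:
  "(U ** rdiag p ** cadjoint U) ** X ** (V ** rdiag q ** cadjoint V) = schur_conj U V X (\<lambda>i j. p i * q j)"
proof -
  have "schur_mult (\<lambda>i j. p i * q j) Y = rdiag p ** Y ** rdiag q" for Y :: "complex^'a^'a"
    by (simp add: schur_mult_def vec_eq_iff rdiag_mult_left rdiag_mult_right mult_ac)
  then show ?thesis by (simp add: schur_conj_def matrix_mul_assoc)
qed

lemma conj_rdiag_1:
  assumes "unitary U"
  shows "U ** rdiag (\<lambda>i. 1) ** cadjoint U = mat 1"
proof -
  have "rdiag (\<lambda>i. 1) = (mat 1 :: complex^'a^'a)"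
    by (simp add: rdiag_def mat_def vec_eq_iff)
  then show ?thesis using assms by (simp add: unitary_def)
qed

lemma mpow_conj_rdiag:
  assumes "unitary U" "A = U ** rdiag d ** cadjoint U"
  shows "mpow A t = U ** rdiag (\<lambda>i. rpow (d i) t) ** cadjoint U"
  unfolding mpow_def fun_calc_eq[OF assms] by (simp add: o_def rpow_def)

section \<open>Combining and comparing weighted sums of squared entries\<close>

lemma weighted_sum_add: "weighted_sum Y c + weighted_sum Y c' = weighted_sum Y (\<lambda>i j. c i j + c' i j)"
  by (simp add: weighted_sum_def sum.distrib algebra_simps)

lemma weighted_sum_scale: "r * weighted_sum Y c = weighted_sum Y (\<lambda>i j. r * c i j)"
  by (simp add: weighted_sum_def sum_distrib_left mult.assoc)

lemma weighted_sum_sum: "(\<Sum>n\<in>M. weighted_sum Y (c n)) = weighted_sum Y (\<lambda>i j. \<Sum>n\<in>M. c n i j)"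
  unfolding weighted_sum_def sum_distrib_right
  by (subst sum.swap, rule sum.cong[OF refl], rule sum.swap)

lemma weighted_sum_mono: "(\<And>i j. c i j \<le> c' i j) \<Longrightarrow> weighted_sum Y c \<le> weighted_sum Y c'"
  unfolding weighted_sum_def by (intro sum_mono mult_right_mono) auto

theorem theorem5p6:
  fixes A B X :: "complex^'n^'n" and N :: nat and \<nu> :: real
  assumes "psd A" and "psd B" and "N \<ge> 2" and "0 \<le> \<nu>" and "\<nu> \<le> 1/4"
  shows "(norm (A ** X + X ** B))\<^sup>2
    + (\<Sum>j=2..N. s_coef j (4*\<nu>) *
        (norm (mpow A (1/2 + k_idx j (4*\<nu>) / 2^(j+1)) ** X ** mpow B (1/2 - k_idx j (4*\<nu>) / 2^(j+1))
             - mpow A (1/2 + (k_idx j (4*\<nu>) + 1) / 2^(j+1)) ** X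
                 ** mpow B (1/2 - (k_idx j (4*\<nu>) + 1) / 2^(j+1))))\<^sup>2)
    + (\<Sum>j=2..N. s_coef j (4*\<nu>) *
        (norm (mpow A (1/2 - k_idx j (4*\<nu>) / 2^(j+1)) ** X ** mpow B (1/2 + k_idx j (4*\<nu>) / 2^(j+1))
             - mpow A (1/2 - (k_idx j (4*\<nu>) + 1) / 2^(j+1)) ** X
                 ** mpow B (1/2 + (k_idx j (4*\<nu>) + 1) / 2^(j+1))))\<^sup>2)
    \<le> (norm (mpow A \<nu> ** X ** mpow B (1 - \<nu>) + mpow A (1 - \<nu>) ** X ** mpow B \<nu>))\<^sup>2
      + 2 * \<nu> * (norm (A ** X - X ** B))\<^sup>2
      + (1 - 2*\<nu>) * ((norm (mpow A (1/2) ** X ** mpow B (1/2) - A ** X))\<^sup>2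
                     + (norm (mpow A (1/2) ** X ** mpow B (1/2) - X ** B))\<^sup>2)"
proof -
  obtain U a where U: "unitary U" "A = U ** rdiag a ** cadjoint U" and a: "\<And>i. 0 \<le> a i"
    using psd_diagonalization[OF assms(1)] by metis
  obtain V b where V: "unitary V" "B = V ** rdiag b ** cadjoint V" and b: "\<And>i. 0 \<le> b i"
    using psd_diagonalization[OF assms(2)] by metis
  \<comment> \<open>The missing factor on the other side is the identity, diagonal with constant
    eigenvalue 1 in any unitary basis.\<close>
  have AX: "A ** X = schur_conj U V X (\<lambda>i j. a i)"
    using conj_rdiag_mult_conj_rdiag[of U a X V "\<lambda>_. 1"] by (simp add: U(2) conj_rdiag_1[OF V(1)])
  have XB: "X ** B = schur_conj U V X (\<lambda>i j. b j)"
    using conj_rdiag_mult_conj_rdiag[of U "\<lambda>_. 1" X V b] by (simp add: V(2) conj_rdiag_1[OF U(1)])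
  have P: "mpow A s ** X ** mpow B t = schur_conj U V X (\<lambda>i j. rpow (a i) s * rpow (b j) t)" for s t
    unfolding mpow_conj_rdiag[OF U] mpow_conj_rdiag[OF V] by (rule conj_rdiag_mult_conj_rdiag)
  \<comment> \<open>Both sides become weighted sums over the same matrix
    \<open>cadjoint U ** X ** V\<close>, so the scalar inequality at each pair \<open>a i\<close>,
    \<open>b j\<close> suffices.\<close>
  show ?thesis
    unfolding AX XB P schur_conj_add schur_conj_diff norm_schur_conj[OF U(1) V(1)]
      weighted_sum_scale weighted_sum_sum weighted_sum_add
    by (intro weighted_sum_mono scalar_inequality a b assms)
qed

end
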